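(* It is not true that for all positive semidefinite matrices $B,\Delta$ (of equal size), all unitarily invariant norms $|||\cdot|||$, and all non-negative increasing concave functions $f:[0,\infty)\to\mathbb{R}$, the inequality $|||f(B+\Delta)-f(B)|||\le|||f(\Delta)|||$ holds. That is, there exist $n\in\mathbb{N}$, $n\times n$ complex positive semidefinite matrices $B,\Delta$, a unitarily invariant norm $|||\cdot|||$ on the $n\times n$ complex matrices, and a non-negative increasing concave function $f:[0,\infty)\to\mathbb{R}$ such that $|||f(B+\Delta)-f(B)|||>|||f(\Delta)|||$.
   Context: A norm on $n\times n$ complex matrices is unitarily invariant if $|||UXV|||=|||X|||$ for all matrices $X$ and all unitary $U,V$. For a positive semidefinite matrix $X$, $f(X)$ is defined by the spectral functional calculus. "Increasing" is meant in the weak sense (non-decreasing). *)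

theory Defs
  imports "HOL-Analysis.Convex" "Jordan_Normal_Form.Schur_Decomposition"
begin

definition unitary_mat :: "nat \<Rightarrow> complex mat \<Rightarrow> bool" where
  "unitary_mat n U \<longleftrightarrow> U \<in> carrier_mat n n \<and>
     mat_adjoint U * U = 1\<^sub>m n \<and> U * mat_adjoint U = 1\<^sub>m n"

definition psd_mat :: "nat \<Rightarrow> complex mat \<Rightarrow> bool" where
  "psd_mat n A \<longleftrightarrow> A \<in> carrier_mat n n \<and> mat_adjoint A = A \<and>
     (\<forall>v \<in> carrier_vec n. 0 \<le> Re ((A *\<^sub>v v) \<bullet>c v))"

definition unitarily_invariant_norm :: "nat \<Rightarrow> (complex mat \<Rightarrow> real) \<Rightarrow> bool" where
  "unitarily_invariant_norm n N \<longleftrightarrow>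
     (\<forall>X \<in> carrier_mat n n. 0 \<le> N X) \<and>
     (\<forall>X \<in> carrier_mat n n. N X = 0 \<longleftrightarrow> X = 0\<^sub>m n n) \<and>
     (\<forall>c. \<forall>X \<in> carrier_mat n n. N (c \<cdot>\<^sub>m X) = cmod c * N X) \<and>
     (\<forall>X \<in> carrier_mat n n. \<forall>Y \<in> carrier_mat n n. N (X + Y) \<le> N X + N Y) \<and>
     (\<forall>X \<in> carrier_mat n n. \<forall>U V. unitary_mat n U \<longrightarrow> unitary_mat n V \<longrightarrow>
        N (U * X * V) = N X)"

definition diagonalizes :: "nat \<Rightarrow> complex mat \<Rightarrow> complex mat \<Rightarrow> (nat \<Rightarrow> real) \<Rightarrow> bool" where
  "diagonalizes n A U d \<longleftrightarrow> unitary_mat n U \<and>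
     A = U * mat_diag n (\<lambda>i. complex_of_real (d i)) * mat_adjoint U"

(* Meaningful for Hermitian A: a unitary diagonalization exists by the spectral theorem, and the
   result does not depend on its choice (lemma spectral_fun_eq). Only the values of f on the
   spectrum matter, so for positive semidefinite A only the restriction of f to {0..}. *)
definition spectral_fun :: "(real \<Rightarrow> real) \<Rightarrow> complex mat \<Rightarrow> complex mat" where
  "spectral_fun f A = (THE Y. \<exists>U d. diagonalizes (dim_row A) A U d \<and>
     Y = U * mat_diag (dim_row A) (\<lambda>i. complex_of_real (f (d i))) * mat_adjoint U)"

lemma mat_adjoint_carrier:
  "U \<in> carrier_mat n n \<Longrightarrow> mat_adjoint U \<in> carrier_mat n n"
  by (rule carrier_matI) (simp_all add: mat_adjoint_def mat_of_rows_def)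

lemma diagonalizesD:
  assumes "diagonalizes n A U d"
  shows "U \<in> carrier_mat n n" "mat_adjoint U * U = 1\<^sub>m n" "U * mat_adjoint U = 1\<^sub>m n"
    "A = U * mat_diag n (\<lambda>i. complex_of_real (d i)) * mat_adjoint U"
proof -
  note * = assms[unfolded diagonalizes_def unitary_mat_def]
  show "U \<in> carrier_mat n n" by (rule *[THEN conjunct1, THEN conjunct1])
  show "mat_adjoint U * U = 1\<^sub>m n"
    by (rule *[THEN conjunct1, THEN conjunct2, THEN conjunct1])
  show "U * mat_adjoint U = 1\<^sub>m n"
    by (rule *[THEN conjunct1, THEN conjunct2, THEN conjunct2])
  show "A = U * mat_diag n (\<lambda>i. complex_of_real (d i)) * mat_adjoint U"
    by (rule *[THEN conjunct2])
qed

lemma diagonalization_unique: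
  assumes "diagonalizes n A U d" "diagonalizes n A V e"
  shows "U * mat_diag n (\<lambda>i. complex_of_real (f (d i))) * mat_adjoint U =
         V * mat_diag n (\<lambda>i. complex_of_real (f (e i))) * mat_adjoint V"
proof -
  define U' V' where "U' = mat_adjoint U" and "V' = mat_adjoint V"
  define D E where "D = mat_diag n (\<lambda>i. complex_of_real (d i))"
    and "E = mat_diag n (\<lambda>i. complex_of_real (e i))"
  define F G where "F = mat_diag n (\<lambda>i. complex_of_real (f (d i)))"
    and "G = mat_diag n (\<lambda>i. complex_of_real (f (e i)))"
  define W where "W = V' * U"
  have U: "U \<in> carrier_mat n n" and V: "V \<in> carrier_mat n n"
    by (rule diagonalizesD(1)[OF assms(1)], rule diagonalizesD(1)[OF assms(2)])
  have U': "U' \<in> carrier_mat n n" and V': "V' \<in> carrier_mat n n"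
    using U V by (auto simp: U'_def V'_def mat_adjoint_carrier)
  have W: "W \<in> carrier_mat n n" using V' U by (auto simp: W_def)
  have D: "D \<in> carrier_mat n n" and E: "E \<in> carrier_mat n n"
    and F: "F \<in> carrier_mat n n" and G: "G \<in> carrier_mat n n"
    by (auto simp: D_def E_def F_def G_def)
  have inv: "U' * U = 1\<^sub>m n" "U * U' = 1\<^sub>m n" "V' * V = 1\<^sub>m n" "V * V' = 1\<^sub>m n"
    unfolding U'_def V'_def
    by (rule diagonalizesD(2,3)[OF assms(1)] diagonalizesD(2,3)[OF assms(2)])+
  have eq: "U * D * U' = V * E * V'"
    unfolding U'_def V'_def D_def E_def
    by (rule diagonalizesD(4)[OF assms(1), symmetric, THEN trans, OF diagonalizesD(4)[OF assms(2)]])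
  have "W * D = V' * (U * D)" unfolding W_def using V' U D by (simp add: assoc_mult_mat[of _ n n _ n _ n])
  also have "U * D = U * D * (U' * U)" unfolding inv(1) using U D by simp
  also have "\<dots> = U * D * U' * U" using U D U'
    by (simp add: assoc_mult_mat[of _ n n _ n _ n])
  also have "U * D * U' * U = V * E * V' * U" unfolding eq ..
  also have "V' * (V * E * V' * U) = (V' * V) * E * W"
    unfolding W_def using V V' E U by (simp add: assoc_mult_mat[of _ n n _ n _ n])
  also have "\<dots> = E * W" unfolding inv(3) using E by simp
  finally have WD: "W * D = E * W" .
  have "W * F = G * W"
  proof (rule eq_matI)
    fix i j assume "i < dim_row (G * W)" "j < dim_col (G * W)"
    then have ij: "i < n" "j < n" using G W by auto
    have "(W * D) $$ (i,j) = (E * W) $$ (i,j)" using WD by simp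
    then have "W $$ (i,j) * complex_of_real (d j) = complex_of_real (e i) * W $$ (i,j)"
      using ij unfolding D_def E_def
      by (simp add: mat_diag_mult_right[OF W] mat_diag_mult_left[OF W])
    then have "W $$ (i,j) = 0 \<or> d j = e i" by auto
    then show "(W * F) $$ (i,j) = (G * W) $$ (i,j)"
      using ij unfolding F_def G_def
      by (auto simp: mat_diag_mult_right[OF W] mat_diag_mult_left[OF W])
  qed (use W F G in auto)
  then have eqW: "V * (W * F) * U' = V * (G * W) * U'" by (rule arg_cong[of _ _ "\<lambda>X. V * X * U'"])
  have "U * F * U' = (V * V') * U * F * U'"
    unfolding inv(4) using U by simp
  also have "\<dots> = V * (W * F) * U'"
    unfolding W_def using V V' U F U' by (simp add: assoc_mult_mat[of _ n n _ n _ n])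
  also note eqW
  also have "V * (G * W) * U' = V * G * V' * (U * U')"
    unfolding W_def using V V' U G U' by (simp add: assoc_mult_mat[of _ n n _ n _ n])
  also have "\<dots> = V * G * V'"
    unfolding inv(2) using V G V' by simp
  finally have "U * F * U' = V * G * V'" .
  then show ?thesis unfolding F_def G_def U'_def V'_def .
qed

lemma spectral_fun_eq:
  assumes "diagonalizes n A U d"
  shows "spectral_fun f A = U * mat_diag n (\<lambda>i. complex_of_real (f (d i))) * mat_adjoint U"
proof -
  have "dim_row A = n"
    using diagonalizesD(1)[OF assms] by (subst diagonalizesD(4)[OF assms]) simp
  show ?thesis
    unfolding spectral_fun_def \<open>dim_row A = n\<close>
  proof (rule the_equality)
    show "\<exists>V e. diagonalizes n A V e \<and>
        U * mat_diag n (\<lambda>i. complex_of_real (f (d i))) * mat_adjoint U =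
        V * mat_diag n (\<lambda>i. complex_of_real (f (e i))) * mat_adjoint V"
      using assms by blast
  next
    fix Y
    assume "\<exists>V e. diagonalizes n A V e \<and>
        Y = V * mat_diag n (\<lambda>i. complex_of_real (f (e i))) * mat_adjoint V"
    then obtain V e where V: "diagonalizes n A V e"
      and Y: "Y = V * mat_diag n (\<lambda>i. complex_of_real (f (e i))) * mat_adjoint V"
      by blast
    show "Y = U * mat_diag n (\<lambda>i. complex_of_real (f (d i))) * mat_adjoint U"
      unfolding Y by (rule diagonalization_unique[OF V assms])
  qed
qed

end

(*
  For f = min(_, c) the failure is already visible to first order. If B = diag(c, 0) and
  \<Delta> = w w* is small with w = (x, y), then f(B + \<Delta>) - f(B) is approximately \<Delta> with its (1,1)
  entry deleted, whose trace norm sqrt(y^4 + 4 x^2 y^2) exceeds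
  tr \<Delta> = x^2 + y^2 when 0 < x^2 < 2 y^2.
  The trace norm is realised as the supremum of \<Sum>i |(U X V)_ii| over unitary U, V.
*)
theory Submission
  imports Defs
begin

section \<open>Unitary matrices: entries, row and column norms, closure properties\<close>

lemma adjoint_index:
  assumes "U \<in> carrier_mat n n" "i < n" "j < n"
  shows "mat_adjoint U $$ (i, j) = cnj (U $$ (j, i))"
  using assms by (simp add: mat_adjoint_def mat_of_rows_def conjugate_vec_def)

lemma index_mult_mat_sum:
  assumes "A \<in> carrier_mat n n" "B \<in> carrier_mat n n" "i < n" "j < n"
  shows "(A * B) $$ (i, j) = (\<Sum>k<n. A $$ (i, k) * B $$ (k, j))"
  using assms by (simp add: scalar_prod_def atLeast0LessThan)

lemma unitary_matD:
  assumes "unitary_mat n U"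
  shows "U \<in> carrier_mat n n" "mat_adjoint U * U = 1\<^sub>m n" "U * mat_adjoint U = 1\<^sub>m n"
  using assms by (auto simp: unitary_mat_def)

lemma unitary_column_norm:
  assumes U: "unitary_mat n U" and j: "j < n"
  shows "(\<Sum>i<n. (cmod (U $$ (i, j)))\<^sup>2) = 1"
proof -
  note c = unitary_matD(1)[OF U]
  have "of_real (\<Sum>i<n. (cmod (U $$ (i, j)))\<^sup>2) = (mat_adjoint U * U) $$ (j, j)"
    using j c by (subst index_mult_mat_sum[OF mat_adjoint_carrier[OF c] c j j])
      (simp add: adjoint_index[OF c] complex_norm_square mult.commute flip: of_real_power)
  also have "\<dots> = of_real 1" using unitary_matD(2)[OF U] j by simp
  finally show ?thesis by (simp only: of_real_eq_iff)
qed

lemma unitary_row_norm: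
  assumes U: "unitary_mat n U" and i: "i < n"
  shows "(\<Sum>j<n. (cmod (U $$ (i, j)))\<^sup>2) = 1"
proof -
  note c = unitary_matD(1)[OF U]
  have "of_real (\<Sum>j<n. (cmod (U $$ (i, j)))\<^sup>2) = (U * mat_adjoint U) $$ (i, i)"
    using i c by (subst index_mult_mat_sum[OF c mat_adjoint_carrier[OF c] i i])
      (simp add: adjoint_index[OF c] complex_norm_square flip: of_real_power)
  also have "\<dots> = of_real 1" using unitary_matD(3)[OF U] i by simp
  finally show ?thesis by (simp only: of_real_eq_iff)
qed

lemma unitary_entry_le_one:
  assumes "unitary_mat n U" "i < n" "j < n"
  shows "cmod (U $$ (i, j)) \<le> 1"
proof -
  have "(cmod (U $$ (i, j)))\<^sup>2 \<le> (\<Sum>j<n. (cmod (U $$ (i, j)))\<^sup>2)"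
    by (rule member_le_sum[of j "{..<n}" "\<lambda>j. (cmod (U $$ (i, j)))\<^sup>2"]) (use assms in auto)
  then have "(cmod (U $$ (i, j)))\<^sup>2 \<le> 1" using unitary_row_norm[OF assms(1,2)] by simp
  then show ?thesis using power2_le_imp_le[of _ 1] by simp
qed

lemma unitary_mat_one: "unitary_mat n (1\<^sub>m n)"
proof -
  have "mat_adjoint (1\<^sub>m n :: complex mat) = 1\<^sub>m n"
    by (rule eq_matI) (auto simp: adjoint_index[of _ n] mat_adjoint_carrier[of _ n, THEN carrier_matD(1)]
      mat_adjoint_carrier[of _ n, THEN carrier_matD(2)])
  then show ?thesis by (simp add: unitary_mat_def)
qed

text \<open>Row swaps later carry an arbitrary entry onto the diagonal, which yields definiteness of
  the trace norm.\<close>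

lemma unitary_mat_swaprows:
  assumes "k < n" "l < n"
  shows "unitary_mat n (swaprows_mat n k l)"
proof -
  have c: "(swaprows_mat n k l :: complex mat) \<in> carrier_mat n n" by simp
  have "mat_adjoint (swaprows_mat n k l :: complex mat) = swaprows_mat n k l"
  proof (rule eq_matI)
    fix i j assume "i < dim_row (swaprows_mat n k l :: complex mat)"
      "j < dim_col (swaprows_mat n k l :: complex mat)"
    then have "i < n" "j < n" by auto
    then show "mat_adjoint (swaprows_mat n k l :: complex mat) $$ (i, j) = swaprows_mat n k l $$ (i, j)"
      unfolding adjoint_index[OF c \<open>i < n\<close> \<open>j < n\<close>] by (auto simp: swaprows_mat_def)
  qed (use mat_adjoint_carrier[OF c] in auto)
  then show ?thesis using swaprows_mat_inv[OF assms] by (simp add: unitary_mat_def)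
qed

lemma unitary_mat_mult:
  assumes U: "unitary_mat n U" and V: "unitary_mat n V"
  shows "unitary_mat n (U * V)"
proof -
  note cU = unitary_matD(1)[OF U] and cV = unitary_matD(1)[OF V]
  note aU = mat_adjoint_carrier[OF cU] and aV = mat_adjoint_carrier[OF cV]
  have cUV: "U * V \<in> carrier_mat n n" using cU cV by simp
  have adj: "mat_adjoint (U * V) = mat_adjoint V * mat_adjoint U"
  proof (rule eq_matI)
    fix i j assume "i < dim_row (mat_adjoint V * mat_adjoint U)"
      "j < dim_col (mat_adjoint V * mat_adjoint U)"
    then have ij: "i < n" "j < n" using aU aV by auto
    show "mat_adjoint (U * V) $$ (i, j) = (mat_adjoint V * mat_adjoint U) $$ (i, j)"
      using ij by (simp add: adjoint_index[OF cUV] adjoint_index[OF cU] adjoint_index[OF cV]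
        index_mult_mat_sum[OF cU cV] index_mult_mat_sum[OF aV aU] mult.commute
        del: index_mult_mat)
  qed (use mat_adjoint_carrier[OF cUV] aU aV in auto)
  have "mat_adjoint V * mat_adjoint U * (U * V) = mat_adjoint V * (mat_adjoint U * U) * V"
    using cU cV aU aV by (simp add: assoc_mult_mat[of _ n n _ n _ n])
  also have "\<dots> = 1\<^sub>m n" using unitary_matD(2)[OF U] unitary_matD(2)[OF V] aV by simp
  finally have 1: "mat_adjoint V * mat_adjoint U * (U * V) = 1\<^sub>m n" .
  have "U * V * (mat_adjoint V * mat_adjoint U) = U * (V * mat_adjoint V) * mat_adjoint U"
    using cU cV aU aV by (simp add: assoc_mult_mat[of _ n n _ n _ n])
  also have "\<dots> = 1\<^sub>m n" using unitary_matD(3)[OF U] unitary_matD(3)[OF V] cU by simp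
  finally show ?thesis using 1 cUV by (simp add: unitary_mat_def adj)
qed

lemma unitary_mat_adjoint:
  assumes U: "unitary_mat n U"
  shows "unitary_mat n (mat_adjoint U)"
proof -
  note c = unitary_matD(1)[OF U] and a = mat_adjoint_carrier[OF unitary_matD(1)[OF U]]
  have "mat_adjoint (mat_adjoint U) = U"
    by (rule eq_matI)
      (use c mat_adjoint_carrier[OF a] in \<open>auto simp: adjoint_index[OF a] adjoint_index[OF c]\<close>)
  then show ?thesis using a unitary_matD[OF U] by (simp add: unitary_mat_def)
qed

section \<open>The trace norm: norm axioms, unitary invariance and a spectral upper bound\<close>

definition diag_abs_sum :: "nat \<Rightarrow> complex mat \<Rightarrow> real" where
  "diag_abs_sum n X = (\<Sum>i<n. cmod (X $$ (i, i)))"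

definition diag_abs_sums :: "nat \<Rightarrow> complex mat \<Rightarrow> real set" where
  "diag_abs_sums n X = {diag_abs_sum n (U * X * V) |U V. unitary_mat n U \<and> unitary_mat n V}"

text \<open>For fixed \<open>U\<close> and \<open>V\<close> the diagonal sum of
  \<open>U * X * V\<close> is a seminorm in \<open>X\<close>. As a supremum of these over all
  unitary pairs, the trace norm inherits the triangle inequality and invariance without a singular
  value decomposition.\<close>

definition trace_norm :: "nat \<Rightarrow> complex mat \<Rightarrow> real" where
  "trace_norm n X = Sup (diag_abs_sums n X)"

lemma diag_abs_sum_nonneg: "0 \<le> diag_abs_sum n X"
  by (simp add: diag_abs_sum_def sum_nonneg)

lemma triple_product_entry:
  assumes "U \<in> carrier_mat n n" "X \<in> carrier_mat n n" "V \<in> carrier_mat n n" "i < n" "j < n"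
  shows "(U * X * V) $$ (i, j) = (\<Sum>l<n. (\<Sum>k<n. U $$ (i, k) * X $$ (k, l)) * V $$ (l, j))"
  using assms
  by (subst index_mult_mat_sum[of _ n]) (auto simp: index_mult_mat_sum[of _ n] simp del: index_mult_mat(1))

text \<open>A real \<open>Sup\<close> is an upper bound only of a bounded set. Entries of unitaries
  have modulus at most 1, so each diagonal entry of \<open>U * X * V\<close> is at most the sum of
  all the moduli in \<open>X\<close>.\<close>

lemma bdd_above_diag_abs_sums:
  assumes X: "X \<in> carrier_mat n n"
  shows "bdd_above (diag_abs_sums n X)"
proof (rule bdd_aboveI)
  fix r assume "r \<in> diag_abs_sums n X"
  then obtain U V where r: "r = diag_abs_sum n (U * X * V)"
    and U: "unitary_mat n U" and V: "unitary_mat n V" by (auto simp: diag_abs_sums_def)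
  have "cmod ((U * X * V) $$ (i, i)) \<le> (\<Sum>l<n. \<Sum>k<n. cmod (X $$ (k, l)))" if i: "i < n" for i
    unfolding triple_product_entry[OF unitary_matD(1)[OF U] X unitary_matD(1)[OF V] i i]
  proof (rule sum_norm_le)
    fix l assume "l \<in> {..<n}"
    then have l: "l < n" by simp
    have "cmod ((\<Sum>k<n. U $$ (i, k) * X $$ (k, l)) * V $$ (l, i))
        \<le> cmod (\<Sum>k<n. U $$ (i, k) * X $$ (k, l))"
      unfolding norm_mult using unitary_entry_le_one[OF V l i] by (intro mult_left_le) auto
    also have "\<dots> \<le> (\<Sum>k<n. cmod (X $$ (k, l)))"
      by (rule sum_norm_le) (auto simp: norm_mult intro!: mult_left_le_one_le unitary_entry_le_one[OF U i])
    finally show "cmod ((\<Sum>k<n. U $$ (i, k) * X $$ (k, l)) * V $$ (l, i))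
      \<le> (\<Sum>k<n. cmod (X $$ (k, l)))" .
  qed
  then have "(\<Sum>i<n. cmod ((U * X * V) $$ (i, i))) \<le> (\<Sum>i<n. \<Sum>l<n. \<Sum>k<n. cmod (X $$ (k, l)))"
    by (intro sum_mono) auto
  then show "r \<le> (\<Sum>i<n. \<Sum>l<n. \<Sum>k<n. cmod (X $$ (k, l)))"
    unfolding r diag_abs_sum_def .
qed

lemma diag_abs_sum_le_trace_norm:
  assumes "X \<in> carrier_mat n n" "unitary_mat n U" "unitary_mat n V"
  shows "diag_abs_sum n (U * X * V) \<le> trace_norm n X"
  unfolding trace_norm_def
  by (rule cSup_upper[OF _ bdd_above_diag_abs_sums[OF assms(1)]])
    (use assms in \<open>auto simp: diag_abs_sums_def\<close>)

lemma trace_norm_leI: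
  assumes "\<And>U V. unitary_mat n U \<Longrightarrow> unitary_mat n V \<Longrightarrow> diag_abs_sum n (U * X * V) \<le> r"
  shows "trace_norm n X \<le> r"
proof -
  \<comment> \<open>The identity pair shows that the set is nonempty, as \<open>cSup_least\<close>
    requires.\<close>
  have "diag_abs_sum n (1\<^sub>m n * X * 1\<^sub>m n) \<in> diag_abs_sums n X"
    using unitary_mat_one unfolding diag_abs_sums_def by blast
  then show ?thesis
    unfolding trace_norm_def
    by (intro cSup_least) (use assms in \<open>auto simp: diag_abs_sums_def\<close>)
qed

lemma trace_norm_nonneg:
  assumes "X \<in> carrier_mat n n"
  shows "0 \<le> trace_norm n X"
  using diag_abs_sum_le_trace_norm[OF assms unitary_mat_one unitary_mat_one] diag_abs_sum_nonneg
  by (rule order_trans[rotated])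

lemma trace_norm_triangle:
  assumes X: "X \<in> carrier_mat n n" and Y: "Y \<in> carrier_mat n n"
  shows "trace_norm n (X + Y) \<le> trace_norm n X + trace_norm n Y"
proof (rule trace_norm_leI)
  fix U V assume U: "unitary_mat n U" and V: "unitary_mat n V"
  note c = unitary_matD(1)[OF U] unitary_matD(1)[OF V]
  have "U * (X + Y) * V = U * X * V + U * Y * V"
    using c X Y by (simp add: mult_add_distrib_mat[of _ n n] add_mult_distrib_mat[of _ n n])
  moreover have "diag_abs_sum n (U * X * V + U * Y * V)
      \<le> diag_abs_sum n (U * X * V) + diag_abs_sum n (U * Y * V)"
    unfolding diag_abs_sum_def sum.distrib[symmetric]
    by (rule sum_mono) (use c X Y in \<open>auto simp del: index_mult_mat(1) intro: norm_triangle_ineq\<close>)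
  ultimately show "diag_abs_sum n (U * (X + Y) * V) \<le> trace_norm n X + trace_norm n Y"
    using diag_abs_sum_le_trace_norm[OF X U V] diag_abs_sum_le_trace_norm[OF Y U V] by simp
qed

lemma trace_norm_smult_le:
  assumes X: "X \<in> carrier_mat n n"
  shows "trace_norm n (c \<cdot>\<^sub>m X) \<le> cmod c * trace_norm n X"
proof (rule trace_norm_leI)
  fix U V assume U: "unitary_mat n U" and V: "unitary_mat n V"
  note cr = unitary_matD(1)[OF U] unitary_matD(1)[OF V]
  have "U * (c \<cdot>\<^sub>m X) * V = c \<cdot>\<^sub>m (U * X * V)"
    using cr X by (simp add: mult_smult_distrib[of _ n n] mult_smult_assoc_mat[of _ n n])
  moreover have "diag_abs_sum n (c \<cdot>\<^sub>m (U * X * V)) = cmod c * diag_abs_sum n (U * X * V)"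
    unfolding diag_abs_sum_def sum_distrib_left
    by (rule sum.cong) (use cr X in \<open>auto simp: norm_mult simp del: index_mult_mat(1)\<close>)
  ultimately show "diag_abs_sum n (U * (c \<cdot>\<^sub>m X) * V) \<le> cmod c * trace_norm n X"
    using diag_abs_sum_le_trace_norm[OF X U V] by (simp add: mult_left_mono)
qed

text \<open>For nonzero \<open>c\<close> the reverse inequality is the one-sided bound applied to
  \<open>inverse c\<close> and the rescaled matrix.\<close>

lemma trace_norm_smult:
  assumes X: "X \<in> carrier_mat n n"
  shows "trace_norm n (c \<cdot>\<^sub>m X) = cmod c * trace_norm n X"
proof (cases "c = 0")
  case True
  then show ?thesis using trace_norm_smult_le[OF X, of c] trace_norm_nonneg[of "c \<cdot>\<^sub>m X" n] X by simp
next
  case False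
  have "inverse c \<cdot>\<^sub>m (c \<cdot>\<^sub>m X) = X" using False X by (auto intro!: eq_matI)
  then have "trace_norm n X \<le> cmod (inverse c) * trace_norm n (c \<cdot>\<^sub>m X)"
    using trace_norm_smult_le[of "c \<cdot>\<^sub>m X" n "inverse c"] X by simp
  then have "cmod c * trace_norm n X \<le> trace_norm n (c \<cdot>\<^sub>m X)"
    using False by (simp add: norm_inverse norm_divide field_simps)
  then show ?thesis using trace_norm_smult_le[OF X, of c] by simp
qed

lemma trace_norm_eq_0_iff:
  assumes X: "X \<in> carrier_mat n n"
  shows "trace_norm n X = 0 \<longleftrightarrow> X = 0\<^sub>m n n"
proof
  assume 0: "trace_norm n X = 0"
  show "X = 0\<^sub>m n n"
  proof (rule eq_matI)
    fix i j assume "i < dim_row (0\<^sub>m n n :: complex mat)" "j < dim_col (0\<^sub>m n n :: complex mat)"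
    then have ij: "i < n" "j < n" by auto
    \<comment> \<open>Swapping rows i and j moves the entry (i, j) of \<open>X\<close> to the
      diagonal position (j, j), where the vanishing supremum controls it.\<close>
    let ?Y = "swaprows_mat n i j * X * 1\<^sub>m n"
    have Y: "?Y = swaprows i j X" using X ij by (simp add: swaprows_mat[OF X])
    have "cmod (?Y $$ (j, j)) \<le> diag_abs_sum n ?Y"
      unfolding diag_abs_sum_def
      by (rule member_le_sum[of j "{..<n}" "\<lambda>j. cmod (?Y $$ (j, j))"]) (use ij in auto)
    also have "\<dots> \<le> 0"
      using diag_abs_sum_le_trace_norm[OF X unitary_mat_swaprows[OF ij] unitary_mat_one] 0 by simp
    finally have "?Y $$ (j, j) = 0" by simp
    then show "X $$ (i, j) = 0\<^sub>m n n $$ (i, j)" unfolding Y using X ij by (auto split: if_splits)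
  qed (use X in auto)
next
  assume "X = 0\<^sub>m n n"
  then show "trace_norm n X = 0" using trace_norm_smult[OF X, of 0] by (simp add: smult_zero_mat)
qed

text \<open>Since P(UXV)Q = (PU)X(VQ), every value competing in the supremum for UXV already
  competes in the one for X.\<close>

lemma trace_norm_unitary_le:
  assumes X: "X \<in> carrier_mat n n" and U: "unitary_mat n U" and V: "unitary_mat n V"
  shows "trace_norm n (U * X * V) \<le> trace_norm n X"
proof (rule trace_norm_leI)
  fix P Q assume P: "unitary_mat n P" and Q: "unitary_mat n Q"
  have "P * (U * X * V) * Q = P * U * X * (V * Q)"
    using X unitary_matD(1)[OF U] unitary_matD(1)[OF V] unitary_matD(1)[OF P] unitary_matD(1)[OF Q]
    by (simp add: assoc_mult_mat[of _ n n _ n _ n])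
  then show "diag_abs_sum n (P * (U * X * V) * Q) \<le> trace_norm n X"
    using diag_abs_sum_le_trace_norm[OF X unitary_mat_mult[OF P U] unitary_mat_mult[OF V Q]] by simp
qed

lemma trace_norm_unitary:
  assumes X: "X \<in> carrier_mat n n" and U: "unitary_mat n U" and V: "unitary_mat n V"
  shows "trace_norm n (U * X * V) = trace_norm n X"
proof (rule antisym[OF trace_norm_unitary_le[OF assms]])
  note c = unitary_matD(1)[OF U] unitary_matD(1)[OF V]
    mat_adjoint_carrier[OF unitary_matD(1)[OF U]] mat_adjoint_carrier[OF unitary_matD(1)[OF V]]
  \<comment> \<open>The reverse inequality is the same bound for the adjoint unitaries, which
    recover \<open>X\<close>.\<close>
  have "mat_adjoint U * (U * X * V) * mat_adjoint V
      = (mat_adjoint U * U) * X * (V * mat_adjoint V)"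
    using X c by (simp add: assoc_mult_mat[of _ n n _ n _ n])
  also have "\<dots> = X" using X unitary_matD(2)[OF U] unitary_matD(3)[OF V] by simp
  finally show "trace_norm n X \<le> trace_norm n (U * X * V)"
    using trace_norm_unitary_le[of "U * X * V" n, OF _ unitary_mat_adjoint[OF U] unitary_mat_adjoint[OF V]]
      X c by simp
qed

lemma unitarily_invariant_trace_norm: "unitarily_invariant_norm n (trace_norm n)"
  unfolding unitarily_invariant_norm_def
  by (simp add: trace_norm_nonneg trace_norm_eq_0_iff trace_norm_smult trace_norm_triangle
      trace_norm_unitary)

text \<open>By the arithmetic-geometric mean inequality, |U_ik| |V_ki| is at most half the sum of
  the squares. Summed over i, these squares give a column norm of \<open>U\<close> and a row norm of
  \<open>V\<close>, both equal to 1, so each |d_k| receives total weight 1.\<close>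

lemma trace_norm_mat_diag_le:
  "trace_norm n (mat_diag n d) \<le> (\<Sum>k<n. cmod (d k))"
proof (rule trace_norm_leI)
  fix U V assume U: "unitary_mat n U" and V: "unitary_mat n V"
  note c = unitary_matD(1)[OF U] unitary_matD(1)[OF V]
  have UD: "(U * mat_diag n d) $$ (i, k) = U $$ (i, k) * d k" if "i < n" "k < n" for i k
    using that by (simp add: mat_diag_mult_right[OF c(1)])
  have UDc: "U * mat_diag n d \<in> carrier_mat n n" using c by simp
  have entry: "(U * mat_diag n d * V) $$ (i, i) = (\<Sum>k<n. U $$ (i, k) * d k * V $$ (k, i))"
    if "i < n" for i
    using that by (simp add: index_mult_mat_sum[OF UDc c(2)] UD del: index_mult_mat(1))
  have "diag_abs_sum n (U * mat_diag n d * V)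
      \<le> (\<Sum>i<n. \<Sum>k<n. cmod (d k) * (((cmod (U $$ (i, k)))\<^sup>2 + (cmod (V $$ (k, i)))\<^sup>2) / 2))"
    unfolding diag_abs_sum_def
  proof (rule sum_mono)
    fix i assume "i \<in> {..<n}"
    then have i: "i < n" by simp
    show "cmod ((U * mat_diag n d * V) $$ (i, i))
        \<le> (\<Sum>k<n. cmod (d k) * (((cmod (U $$ (i, k)))\<^sup>2 + (cmod (V $$ (k, i)))\<^sup>2) / 2))"
      unfolding entry[OF i]
    proof (rule sum_norm_le)
      fix k
      have "cmod (U $$ (i, k)) * cmod (V $$ (k, i))
          \<le> ((cmod (U $$ (i, k)))\<^sup>2 + (cmod (V $$ (k, i)))\<^sup>2) / 2"
        using sum_squares_bound[of "cmod (U $$ (i, k))" "cmod (V $$ (k, i))"] by simp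
      from mult_left_mono[OF this norm_ge_zero[of "d k"]]
      show "cmod (U $$ (i, k) * d k * V $$ (k, i))
          \<le> cmod (d k) * (((cmod (U $$ (i, k)))\<^sup>2 + (cmod (V $$ (k, i)))\<^sup>2) / 2)"
        by (simp add: norm_mult mult_ac)
    qed
  qed
  also have "\<dots> = (\<Sum>k<n. cmod (d k) * (((\<Sum>i<n. (cmod (U $$ (i, k)))\<^sup>2) + (\<Sum>i<n. (cmod (V $$ (k, i)))\<^sup>2)) / 2))"
    by (subst sum.swap) (simp add: sum_distrib_left[symmetric] sum_divide_distrib[symmetric] sum.distrib)
  also have "\<dots> = (\<Sum>k<n. cmod (d k))"
    by (rule sum.cong) (auto simp: unitary_column_norm[OF U] unitary_row_norm[OF V])
  finally show "diag_abs_sum n (U * mat_diag n d * V) \<le> (\<Sum>k<n. cmod (d k))" .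
qed

text \<open>This bounds the side with \<open>\<Delta>\<close> from above; the other side is bounded
  from below by exhibiting a single pair of unitaries.\<close>

lemma trace_norm_spectral_fun_le:
  assumes "diagonalizes n A U d"
  shows "trace_norm n (spectral_fun f A) \<le> (\<Sum>k<n. \<bar>f (d k)\<bar>)"
proof -
  have U: "unitary_mat n U" using assms by (simp add: diagonalizes_def)
  show ?thesis
    unfolding spectral_fun_eq[OF assms]
    using trace_norm_mat_diag_le[of n "\<lambda>k. complex_of_real (f (d k))"]
    by (simp add: trace_norm_unitary[OF _ U unitary_mat_adjoint[OF U]])
qed

section \<open>Explicit arithmetic of real 2x2 matrices\<close>

definition mat2 :: "real \<Rightarrow> real \<Rightarrow> real \<Rightarrow> real \<Rightarrow> complex mat" where
  "mat2 a b c d = mat 2 2 (\<lambda>(i, j). complex_of_real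
     (if i = 0 then if j = 0 then a else b else if j = 0 then c else d))"

lemma mat2_carrier [simp]: "mat2 a b c d \<in> carrier_mat 2 2"
  "dim_row (mat2 a b c d) = 2" "dim_col (mat2 a b c d) = 2"
  by (auto simp: mat2_def)

lemma mat2_index [simp]:
  "mat2 a b c d $$ (0, 0) = of_real a" "mat2 a b c d $$ (0, Suc 0) = of_real b"
  "mat2 a b c d $$ (Suc 0, 0) = of_real c" "mat2 a b c d $$ (Suc 0, Suc 0) = of_real d"
  by (auto simp: mat2_def)

lemma mat2_eqI:
  assumes "A \<in> carrier_mat 2 2" "A $$ (0, 0) = of_real a" "A $$ (0, Suc 0) = of_real b"
    "A $$ (Suc 0, 0) = of_real c" "A $$ (Suc 0, Suc 0) = of_real d"
  shows "A = mat2 a b c d"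
  by (rule eq_matI) (use assms in \<open>auto simp: less_2_cases_iff\<close>)

lemma mat2_mult: "mat2 a b c d * mat2 a' b' c' d' =
    mat2 (a * a' + b * c') (a * b' + b * d') (c * a' + d * c') (c * b' + d * d')"
  by (rule mat2_eqI) (auto simp: index_mult_mat_sum[OF mat2_carrier(1) mat2_carrier(1)]
    lessThan_nat_numeral simp del: index_mult_mat(1))

lemma mat2_plus: "mat2 a b c d + mat2 a' b' c' d' = mat2 (a + a') (b + b') (c + c') (d + d')"
  by (rule mat2_eqI) auto

lemma mat2_minus: "mat2 a b c d - mat2 a' b' c' d' = mat2 (a - a') (b - b') (c - c') (d - d')"
  by (rule mat2_eqI) (auto intro!: minus_carrier_mat)

lemma mat2_adjoint: "mat_adjoint (mat2 a b c d) = mat2 a c b d"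
  by (rule mat2_eqI) (auto simp: adjoint_index[of _ 2] mat_adjoint_carrier)

lemma mat2_one: "1\<^sub>m 2 = mat2 1 0 0 1"
  by (rule mat2_eqI) auto

lemma mat2_diag: "mat_diag 2 (\<lambda>i. complex_of_real (d i)) = mat2 (d 0) 0 0 (d 1)"
  by (rule mat2_eqI) (auto simp: mat_diag_def)

text \<open>With these rules, checking unitarity and diagonalizations reduces to identities between
  rational numbers.\<close>

lemmas mat2_simps = mat2_mult mat2_plus mat2_minus mat2_adjoint mat2_one mat2_diag

text \<open>The matrix is k w w^T with w = (a, b) real, so its quadratic form at v is k |a v_0 + b
  v_1|^2, split below into real and imaginary parts. Both \<open>B\<close> and
  \<open>\<Delta>\<close> have this shape.\<close>

lemma psd_mat2_rank_one:
  assumes "0 \<le> k"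
  shows "psd_mat 2 (mat2 (k * a\<^sup>2) (k * a * b) (k * a * b) (k * b\<^sup>2))"
  unfolding psd_mat_def
proof (intro conjI ballI)
  fix v :: "complex vec" assume v: "v \<in> carrier_vec 2"
  have "Re ((mat2 (k * a\<^sup>2) (k * a * b) (k * a * b) (k * b\<^sup>2) *\<^sub>v v) \<bullet>c v)
      = k * ((a * Re (v $ 0) + b * Re (v $ 1))\<^sup>2 + (a * Im (v $ 0) + b * Im (v $ 1))\<^sup>2)"
    using v by (simp add: scalar_prod_def numeral_2_eq_2 mult_mat_vec_def mat2_def)
      (simp add: algebra_simps power2_eq_square)
  also have "\<dots> \<ge> 0" using assms by simp
  finally show "0 \<le> Re ((mat2 (k * a\<^sup>2) (k * a * b) (k * a * b) (k * b\<^sup>2) *\<^sub>v v) \<bullet>c v)" .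
qed (auto simp: mat2_adjoint)

section \<open>The 2x2 counterexample\<close>

theorem mainTheorem8:
  shows "\<exists>(n :: nat) (B :: complex mat) (\<Delta> :: complex mat) (N :: complex mat \<Rightarrow> real)
      (f :: real \<Rightarrow> real).
    psd_mat n B \<and> psd_mat n \<Delta> \<and> unitarily_invariant_norm n N \<and>
    (\<forall>x \<ge> 0. 0 \<le> f x) \<and> mono_on {0..} f \<and> concave_on {0..} f \<and>
    N (spectral_fun f (B + \<Delta>) - spectral_fun f B) > N (spectral_fun f \<Delta>)"
proof -
  \<comment> \<open>The cutoff 238 is the value of c for which (12, 5) is an eigenvector of diag(c,
    0) + \<open>\<Delta>\<close>. It leaves \<open>B\<close> and \<open>\<Delta>\<close> fixed under
    \<open>f\<close>, and truncates only the eigenvalue 288 of \<open>B + \<Delta>\<close>.\<close>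
  define f :: "real \<Rightarrow> real" where "f = (\<lambda>x. min x 238)"
  \<comment> \<open>All three spectral decompositions are rational: \<open>\<Delta>\<close> has eigenvalues 169, 0 and \<open>B + \<Delta>\<close> has
    eigenvalues 288, 119, with eigenvectors (5, 12), (-12, 5) and (12, 5), (-5, 12).\<close>
  define B where "B = mat2 238 0 0 0"
  define \<Delta> where "\<Delta> = mat2 25 60 60 144"
  have B: "psd_mat 2 B" using psd_mat2_rank_one[of 238 1 0] by (simp add: B_def)
  have D: "psd_mat 2 \<Delta>" using psd_mat2_rank_one[of 1 5 12] by (simp add: \<Delta>_def)
  have conc: "concave_on {0..} f"
    unfolding concave_on_iff
  proof (intro conjI ballI allI impI)
    fix x y u v :: real assume "0 \<le> u" "0 \<le> v" "u + v = 1"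
    \<comment> \<open>A minimum of affine functions is concave: each weighted minimum is bounded by
      both of its arguments, and the bounds are added.\<close>
    moreover from this have "u * min x 238 \<le> u * x" "v * min y 238 \<le> v * y"
      "u * min x 238 \<le> u * 238" "v * min y 238 \<le> v * 238" by (auto intro: mult_left_mono)
    moreover have "u * 238 + v * 238 = 238" using \<open>u + v = 1\<close> by (simp flip: distrib_right)
    ultimately show "u * f x + v * f y \<le> f (u *\<^sub>R x + v *\<^sub>R y)" by (simp add: f_def)
  qed simp
  have dB: "diagonalizes 2 B (1\<^sub>m 2) (\<lambda>i. if i = 0 then 238 else 0)"
    unfolding diagonalizes_def by (rule conjI[OF unitary_mat_one]) (simp add: B_def mat2_simps)
  have dD: "diagonalizes 2 \<Delta> (mat2 (5/13) (-12/13) (12/13) (5/13)) (\<lambda>i. if i = 0 then 169 else 0)"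
    by (simp add: diagonalizes_def unitary_mat_def \<Delta>_def mat2_simps)
  have dA: "diagonalizes 2 (B + \<Delta>) (mat2 (12/13) (-5/13) (5/13) (12/13))
      (\<lambda>i. if i = 0 then 288 else 119)"
    by (simp add: diagonalizes_def unitary_mat_def B_def \<Delta>_def mat2_simps)
  define M where "M = spectral_fun f (B + \<Delta>) - spectral_fun f B"
  \<comment> \<open>As \<open>f\<close> fixes \<open>B\<close> and lowers 288 by 50,
    \<open>M\<close> is \<open>\<Delta>\<close> minus 50 times the projection onto (12, 5). Its
    determinant is negative, so its trace norm exceeds its trace 119.\<close>
  have M: "M = mat2 (-2975/169) (7140/169) (7140/169) (23086/169)"
    unfolding M_def spectral_fun_eq[OF dA] spectral_fun_eq[OF dB] by (simp add: mat2_simps f_def)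
  \<comment> \<open>A rational approximation of the unitary polar factor of \<open>M\<close>, accurate enough to
    separate the trace norm of \<open>M\<close> (about 175.8) from 169.\<close>
  have W: "unitary_mat 2 (mat2 (-4/5) (3/5) (3/5) (4/5))"
    by (simp add: unitary_mat_def mat2_simps)
  have "trace_norm 2 (spectral_fun f \<Delta>) \<le> 169"
    using trace_norm_spectral_fun_le[OF dD, of f] by (simp add: f_def numeral_2_eq_2)
  \<comment> \<open>The two diagonal entries of the product are positive and add up to about
    174.06.\<close>
  also have "169 < diag_abs_sum 2 (mat2 (-4/5) (3/5) (3/5) (4/5) * M * 1\<^sub>m 2)"
    by (simp add: M mat2_simps diag_abs_sum_def numeral_2_eq_2)
  also have "\<dots> \<le> trace_norm 2 M"
    by (rule diag_abs_sum_le_trace_norm[OF _ W unitary_mat_one]) (simp add: M)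
  finally have "trace_norm 2 (spectral_fun f \<Delta>)
      < trace_norm 2 (spectral_fun f (B + \<Delta>) - spectral_fun f B)" unfolding M_def .
  moreover have "mono_on {0..} f" by (auto simp: f_def mono_on_def)
  moreover have "\<forall>x\<ge>0. 0 \<le> f x" by (simp add: f_def)
  ultimately show ?thesis using B D conc unitarily_invariant_trace_norm by blast
qed

end
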